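(* The set $\mathcal S$ of saddle points of $L$ over $\mathcal X\times\mathcal Y$ coincides with the set of equilibrium points of the differential inclusion $$\dot x(t)\in -\nabla^2R_x(x(t))^{-1}\big(\partial_xL(x(t),\gamma(t))+\mathcal N_{\mathcal X}(x(t))\big),\qquad \dot\gamma(t)\in \nabla^2R_\gamma(\gamma(t))^{-1}\big(\partial_\gamma^+L(x(t),\gamma(t))-\mathcal N_{\mathcal Y}(\gamma(t))\big),$$ that is, with the set of points $(x,\gamma)\in\mathcal X\times\mathcal Y$ such that $0\in -\nabla^2R_x(x)^{-1}(\partial_xL(x,\gamma)+\mathcal N_{\mathcal X}(x))$ and $0\in\nabla^2R_\gamma(\gamma)^{-1}(\partial_\gamma^+L(x,\gamma)-\mathcal N_{\mathcal Y}(\gamma))$.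
   Context: Setting. $\mathcal X\subseteq\mathbb R^n$, $\mathcal Y\subseteq\mathbb R^m$ are nonempty, convex and compact. $L:\mathbb R^n\times\mathbb R^m\to[-\infty,+\infty]$ is convex in $x\in\mathbb R^n$ and concave in $\gamma\in\mathbb R^m$. For $(x,\gamma)\in\mathcal X\times\mathcal Y$, $\partial_xL(x,\gamma)=\{g\in\mathbb R^n: L(y,\gamma)\ge L(x,\gamma)+\langle g,y-x\rangle\ \forall y\in\mathbb R^n\}$ and $\partial_\gamma^+L(x,\gamma)=\{g\in\mathbb R^m: L(x,\delta)\le L(x,\gamma)+\langle g,\delta-\gamma\rangle\ \forall \delta\in\mathbb R^m\}$. A saddle point is $(x^*,\gamma^* )\in\mathcal X\times\mathcal Y$ with $L(x^*,\gamma)\le L(x^*,\gamma^* )\le L(x,\gamma^* )$ for all $x\in\mathcal X,\gamma\in\mathcal Y$; $\mathcal S$ is the set of saddle points. Standing assumptions. (A1) $\mathcal S$ is nonempty and compact, and for every $(x,\gamma)\in(\mathcal X\times\mathcal Y)\setminus\mathcal S$ there is $(x^*,\gamma^* )\in\mathcal S$ with $L(x^*,\gamma)<L(x^*,\gamma^* )$ or $L(x^*,\gamma^* )<L(x,\gamma^* )$. (A2) For each $x\in\mathcal X$, $L(x,\cdot)$ is upper semicontinuous on $\mathbb R^m$; for each $\gamma\in\mathcal Y$, $L(\cdot,\gamma)$ is lower semicontinuous on $\mathbb R^n$. (A3) For each $(x,\gamma)\in\mathcal X\times\mathcal Y$, $\partial_xL(x,\gamma)\times\partial_\gamma^+L(x,\gamma)$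 is nonempty, and there is $G>0$ such that all elements of $\partial_xL(x,\gamma)$ and $\partial^+_\gamma L(x,\gamma)$, for all $(x,\gamma)\in\mathcal X\times\mathcal Y$, have norm at most $G$. $R_x$ (on $\mathbb R^n$) and $R_\gamma$ (on $\mathbb R^m$) are extended-real-valued functions, twice continuously differentiable and $\sigma_R$-strongly convex ($\sigma_R>0$) on open sets containing $\mathcal X$ and $\mathcal Y$ respectively. Tangent and normal cones of a closed convex set $\mathcal C$ at $x\in \mathcal C$: $\mathcal T_{\mathcal C}(x)=\{v: v=\lim_k (x_k-x)/t_k,\ x_k\in\mathcal C,\ t_k\downarrow0\}$ and $\mathcal N_{\mathcal C}(x)=\{\eta:\langle\eta,v\rangle\le0\ \forall v\in\mathcal T_{\mathcal C}(x)\}$. An equilibrium point of a differential inclusion $\dot z\in F(z)$ is a point $z_e$ with $0\in F(z_e)$. *)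

theory Defs
  imports "HOL-Analysis.Analysis"
begin

(* Extended-real-valued functions may take both values \<infinity> and -\<infinity>, so convexity is
   convexity of the epigraph, as a subset of 'a \<times> real. *)
definition ereal_convex :: "('a::real_vector \<Rightarrow> ereal) \<Rightarrow> bool" where
  "ereal_convex f \<longleftrightarrow> convex {(x, r::real). f x \<le> ereal r}"

definition ereal_concave :: "('a::real_vector \<Rightarrow> ereal) \<Rightarrow> bool" where
  "ereal_concave f \<longleftrightarrow> ereal_convex (\<lambda>x. - f x)"

definition lower_semicontinuous :: "('a::topological_space \<Rightarrow> ereal) \<Rightarrow> bool" where
  "lower_semicontinuous f \<longleftrightarrow> (\<forall>x. \<forall>a < f x. \<forall>\<^sub>F y in nhds x. a < f y)"

definition upper_semicontinuous :: "('a::topological_space \<Rightarrow> ereal) \<Rightarrow> bool" where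
  "upper_semicontinuous f \<longleftrightarrow> (\<forall>x. \<forall>a > f x. \<forall>\<^sub>F y in nhds x. f y < a)"

definition subdifferential :: "('a::real_inner \<Rightarrow> ereal) \<Rightarrow> 'a \<Rightarrow> 'a set" where
  "subdifferential f x = {g. \<forall>y. f y \<ge> f x + ereal (g \<bullet> (y - x))}"

definition superdifferential :: "('a::real_inner \<Rightarrow> ereal) \<Rightarrow> 'a \<Rightarrow> 'a set" where
  "superdifferential f x = {g. \<forall>y. f y \<le> f x + ereal (g \<bullet> (y - x))}"

definition saddle_points :: "'a set \<Rightarrow> 'b set \<Rightarrow> ('a \<Rightarrow> 'b \<Rightarrow> ereal) \<Rightarrow> ('a \<times> 'b) set" where
  "saddle_points X Y L =
     {(xs, gs) \<in> X \<times> Y. \<forall>x\<in>X. \<forall>\<gamma>\<in>Y. L xs \<gamma> \<le> L xs gs \<and> L xs gs \<le> L x gs}"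

definition tangent_cone :: "'a::real_normed_vector set \<Rightarrow> 'a \<Rightarrow> 'a set" where
  "tangent_cone C x =
     {v. \<exists>(z :: nat \<Rightarrow> 'a) (t :: nat \<Rightarrow> real).
           (\<forall>k. z k \<in> C) \<and> (\<forall>k. 0 < t k) \<and> decseq t \<and> t \<longlonglongrightarrow> 0 \<and>
           (\<lambda>k. (1 / t k) *\<^sub>R (z k - x)) \<longlonglongrightarrow> v}"

definition normal_cone :: "'a::real_inner set \<Rightarrow> 'a \<Rightarrow> 'a set" where
  "normal_cone C x = {\<eta>. \<forall>v \<in> tangent_cone C x. \<eta> \<bullet> v \<le> 0}"

definition gradient :: "(real^'n \<Rightarrow> real) \<Rightarrow> real^'n \<Rightarrow> real^'n" where
  "gradient f x = (\<chi> i. frechet_derivative f (at x) (axis i 1))"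

definition hessian :: "(real^'n \<Rightarrow> real) \<Rightarrow> real^'n \<Rightarrow> real^'n^'n" where
  "hessian f x = jacobian (gradient f) (at x)"

(* Intended for open S, where differentiable_on is differentiability at each point. *)
definition C2_on :: "(real^'n) set \<Rightarrow> (real^'n \<Rightarrow> real) \<Rightarrow> bool" where
  "C2_on S f \<longleftrightarrow> f differentiable_on S \<and> gradient f differentiable_on S \<and>
                 continuous_on S (hessian f)"

definition strongly_convex_on :: "'a::real_normed_vector set \<Rightarrow> real \<Rightarrow> ('a \<Rightarrow> real) \<Rightarrow> bool" where
  "strongly_convex_on S \<sigma> f \<longleftrightarrow> convex S \<and>
     (\<forall>x\<in>S. \<forall>y\<in>S. \<forall>u\<ge>0. \<forall>v\<ge>0. u + v = 1 \<longrightarrow>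
        f (u *\<^sub>R x + v *\<^sub>R y) \<le> u * f x + v * f y - \<sigma> / 2 * u * v * (norm (x - y))\<^sup>2)"

(* R is extended-real-valued, finite near C; smoothness and strong convexity concern its real
   values there.  As in convex_on, the domain of strong convexity is convex; since every open
   set containing a compact convex set contains a convex open set containing it, this does not
   restrict R when C is compact and convex. *)
definition regularizer_on :: "(real^'n) set \<Rightarrow> real \<Rightarrow> (real^'n \<Rightarrow> ereal) \<Rightarrow> bool" where
  "regularizer_on C \<sigma> R \<longleftrightarrow>
     (\<exists>U. open U \<and> C \<subseteq> U \<and> (\<forall>x\<in>U. \<bar>R x\<bar> \<noteq> \<infinity>) \<and>
          C2_on U (\<lambda>x. real_of_ereal (R x)) \<and>
          strongly_convex_on U \<sigma> (\<lambda>x. real_of_ereal (R x)))"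

abbreviation inv_hessian :: "(real^'n \<Rightarrow> ereal) \<Rightarrow> real^'n \<Rightarrow> real^'n^'n" where
  "inv_hessian R x \<equiv> matrix_inv (hessian (\<lambda>y. real_of_ereal (R y)) x)"

definition equilibrium_points :: "'z set \<Rightarrow> ('z \<Rightarrow> 'z::zero set) \<Rightarrow> 'z set" where
  "equilibrium_points D F = {z \<in> D. 0 \<in> F z}"

(* The two sums of sets are Minkowski sums; the binary minus of the library on sets is set
   difference. *)
definition saddle_inclusion ::
  "(real^'n) set \<Rightarrow> (real^'m) set \<Rightarrow> (real^'n \<Rightarrow> ereal) \<Rightarrow> (real^'m \<Rightarrow> ereal) \<Rightarrow>
   (real^'n \<Rightarrow> real^'m \<Rightarrow> ereal) \<Rightarrow> (real^'n) \<times> (real^'m) \<Rightarrow> ((real^'n) \<times> (real^'m)) set" where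
  "saddle_inclusion X Y Rx Rg L = (\<lambda>(x, \<gamma>).
     {- (inv_hessian Rx x *v (g + \<eta>)) | g \<eta>.
        g \<in> subdifferential (\<lambda>y. L y \<gamma>) x \<and> \<eta> \<in> normal_cone X x} \<times>
     {inv_hessian Rg \<gamma> *v (g - \<eta>) | g \<eta>.
        g \<in> superdifferential (L x) \<gamma> \<and> \<eta> \<in> normal_cone Y \<gamma>})"

end

theory Submission
  imports Defs
begin

text \<open>
  A pair \<open>(x, \<gamma>)\<close> is a saddle point iff \<open>x\<close> minimizes \<open>L \<cdot> \<gamma>\<close> over \<open>X\<close> and \<open>\<gamma>\<close> maximizes \<open>L x \<cdot>\<close> over \<open>Y\<close>,
  so everything rests on the first-order optimality condition for a constrained convex problem,
  \<open>0 \<in> \<partial>f(x) + N\<^sub>C(x)\<close> (lemma \<open>minimizer_iff_subgradient_normal\<close>), together with the invertibility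
  of the Hessians, which makes the factors \<open>\<nabla>\<^sup>2R\<^sup>-\<^sup>1\<close> irrelevant for the vanishing of the right-hand side
  (lemma \<open>inv_hessian_mult_eq_0_iff\<close>).

  Sufficiency of the optimality condition is the subgradient inequality.  Necessity is usually
  derived from the sum rule for \<open>f\<close> plus the indicator of \<open>C\<close>, which needs a constraint qualification.
  Here the qualification comes from the boundedness of the subdifferential.
  The epigraph of \<open>f\<close> is separated from \<open>C \<times> {..< f x}\<close> by a hyperplane; if the hyperplane is not
  vertical, its slope is the required subgradient, and if it is vertical, then one of its normals can be
  added to any subgradient arbitrarily often, so that the subdifferential would be unbounded.
  Boundedness also forces \<open>L\<close> to be finite on \<open>X \<times> Y\<close>: where the value is infinite and a subgradient
  exists, every vector is a subgradient.

  The Hessian is invertible because strong convexity makes the gradient strongly monotone,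
  and differentiating this inequality along a line gives \<open>v \<bullet> H v \<ge> \<sigma> |v|\<^sup>2\<close>, so that \<open>H\<close>
  has trivial kernel.
\<close>

section \<open>Normal cones of convex sets\<close>

text \<open>
  For convex \<open>C\<close> every direction \<open>y - x\<close> into \<open>C\<close> is tangent, by moving along the segment; conversely
  tangent directions are limits of positive multiples of such directions.
\<close>

lemma normal_cone_convex_iff:
  fixes C :: "'a::real_inner set"
  assumes "convex C" and x: "x \<in> C"
  shows "\<eta> \<in> normal_cone C x \<longleftrightarrow> (\<forall>y\<in>C. \<eta> \<bullet> (y - x) \<le> 0)"
proof
  assume \<eta>: "\<eta> \<in> normal_cone C x"
  show "\<forall>y\<in>C. \<eta> \<bullet> (y - x) \<le> 0"
  proof
    fix y assume y: "y \<in> C"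
    define t :: "nat \<Rightarrow> real" where "t k = 1 / (real k + 1)" for k
    define z where "z k = x + t k *\<^sub>R (y - x)" for k
    have t_pos: "0 < t k" and t_le: "t k \<le> 1" for k
      by (auto simp: t_def)
    have "z k \<in> C" for k
    proof -
      have "(1 - t k) *\<^sub>R x + t k *\<^sub>R y \<in> C"
        using convexD_alt[OF \<open>convex C\<close> x y] t_pos[of k] t_le[of k] by simp
      then show ?thesis
        by (simp add: z_def algebra_simps)
    qed
    moreover have "decseq t"
      by (auto simp: decseq_def t_def intro!: frac_le)
    moreover have "t \<longlonglongrightarrow> 0"
      unfolding t_def using LIMSEQ_inverse_real_of_nat by (simp add: inverse_eq_divide add.commute)
    moreover have "(1 / t k) *\<^sub>R (z k - x) = y - x" for k
      using t_pos[of k] by (simp add: z_def)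
    ultimately have "y - x \<in> tangent_cone C x"
      unfolding tangent_cone_def using t_pos by (auto intro!: exI[of _ z] exI[of _ t])
    then show "\<eta> \<bullet> (y - x) \<le> 0"
      using \<eta> by (auto simp: normal_cone_def)
  qed
next
  assume le: "\<forall>y\<in>C. \<eta> \<bullet> (y - x) \<le> 0"
  have "\<eta> \<bullet> v \<le> 0" if v: "v \<in> tangent_cone C x" for v
  proof -
    obtain z t where z: "\<And>k::nat. z k \<in> C" and t: "\<And>k. (0::real) < t k"
      and lim: "(\<lambda>k. (1 / t k) *\<^sub>R (z k - x)) \<longlonglongrightarrow> v"
      using v by (auto simp: tangent_cone_def)
    have "(\<lambda>k. \<eta> \<bullet> ((1 / t k) *\<^sub>R (z k - x))) \<longlonglongrightarrow> \<eta> \<bullet> v"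
      by (intro tendsto_intros lim)
    moreover have "\<eta> \<bullet> ((1 / t k) *\<^sub>R (z k - x)) \<le> 0" for k
      using le z t[of k] by (simp add: divide_nonpos_pos)
    ultimately show ?thesis
      by (intro LIMSEQ_le_const2) auto
  qed
  then show "\<eta> \<in> normal_cone C x"
    by (simp add: normal_cone_def)
qed

section \<open>Optimality conditions on a convex set\<close>

text \<open>
  Where \<open>f\<close> takes the value \<open>-\<infinity>\<close>, or the value \<open>\<infinity>\<close> and has a subgradient (so that \<open>f\<close> is identically
  \<open>\<infinity>\<close>), the subgradient inequality holds for every vector.
\<close>

lemma bounded_subdifferential_finite:
  fixes f :: "'a::euclidean_space \<Rightarrow> ereal"
  assumes g: "g \<in> subdifferential f x" and bdd: "bounded (subdifferential f x)"
  shows "\<bar>f x\<bar> \<noteq> \<infinity>"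
proof
  assume "\<bar>f x\<bar> = \<infinity>"
  moreover have "f y \<ge> f x + ereal (g \<bullet> (y - x))" for y
    using g by (simp add: subdifferential_def)
  ultimately have "subdifferential f x = UNIV"
    by (cases "f x") (auto simp: subdifferential_def)
  then show False
    using bdd not_bounded_UNIV by metis
qed

text \<open>
  The hypothesis on \<open>a\<close> makes it a normal at \<open>x\<close> to the effective domain of \<open>f\<close>.  Adding such a vector to a
  subgradient does not raise the affine minorant where \<open>f\<close> is below \<open>\<infinity>\<close>, so it is a recession
  direction of the subdifferential, and a bounded set has only the recession direction \<open>0\<close>.
\<close>

lemma domain_normal_eq_0_if_bounded_subdifferential:
  fixes f :: "'a::euclidean_space \<Rightarrow> ereal"
  assumes g: "g \<in> subdifferential f x" and bdd: "bounded (subdifferential f x)"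
    and normal: "\<And>y. f y \<noteq> \<infinity> \<Longrightarrow> a \<bullet> (y - x) \<le> 0"
  shows "a = 0"
proof (rule ccontr)
  assume a: "a \<noteq> 0"
  obtain c where c: "f x = ereal c"
    using bounded_subdifferential_finite[OF g bdd] by (cases "f x") auto
  have mem: "g + t *\<^sub>R a \<in> subdifferential f x" if "t \<ge> 0" for t
  proof -
    have "f y \<ge> f x + ereal ((g + t *\<^sub>R a) \<bullet> (y - x))" for y
    proof (cases "f y = \<infinity>")
      case False
      have "t * (a \<bullet> (y - x)) \<le> 0"
        using normal[OF False] that by (rule mult_nonneg_nonpos[rotated])
      then have "f x + ereal ((g + t *\<^sub>R a) \<bullet> (y - x)) \<le> f x + ereal (g \<bullet> (y - x))"
        by (simp add: c inner_add_left)
      also have "\<dots> \<le> f y"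
        using g by (simp add: subdifferential_def)
      finally show ?thesis .
    qed simp
    then show ?thesis
      by (simp add: subdifferential_def)
  qed
  obtain B where B: "\<And>h. h \<in> subdifferential f x \<Longrightarrow> norm h \<le> B"
    using bdd by (auto simp: bounded_iff)
  define t where "t = (B + norm g + 1) / norm a"
  have "0 \<le> B"
    using B[OF g] norm_ge_zero order_trans by blast
  then have "B + norm g + 1 \<ge> 0" and "t \<ge> 0"
    unfolding t_def by auto
  \<comment> \<open>this \<open>t\<close> makes \<open>t *\<^sub>R a\<close> longer than the bound allows even after cancellation with \<open>g\<close>\<close>
  have "norm (t *\<^sub>R a) = B + norm g + 1"
    using a \<open>B + norm g + 1 \<ge> 0\<close> by (simp add: t_def)
  moreover have "norm (t *\<^sub>R a) \<le> norm (g + t *\<^sub>R a) + norm g"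
    using norm_triangle_ineq4[of "g + t *\<^sub>R a" g] by simp
  moreover have "norm (g + t *\<^sub>R a) \<le> B"
    using B mem \<open>t \<ge> 0\<close> by blast
  ultimately show False
    by simp
qed

text \<open>
  The convex sets separated in the proof are \<open>C \<times> {..< f x}\<close> and the epigraph; the point \<open>(x, f x)\<close> lies in
  the closure of both and hence on the hyperplane.
\<close>

lemma minimizer_imp_subgradient_normal:
  fixes f :: "'a::euclidean_space \<Rightarrow> ereal"
  assumes f: "ereal_convex f" and C: "convex C" and x: "x \<in> C"
    and ne: "subdifferential f x \<noteq> {}" and bdd: "bounded (subdifferential f x)"
    and min: "\<And>y. y \<in> C \<Longrightarrow> f x \<le> f y"
  obtains g where "g \<in> subdifferential f x" "- g \<in> normal_cone C x"
proof -
  obtain g0 where g0: "g0 \<in> subdifferential f x"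
    using ne by auto
  obtain c where c: "f x = ereal c"
    using bounded_subdifferential_finite[OF g0 bdd] by (cases "f x") auto
  define E where "E = {(y, r::real). f y \<le> ereal r}"
  have xE: "(x, r) \<in> E" if "c \<le> r" for r
    using that by (simp add: E_def c)
  have "convex (C \<times> {..<c})" "convex E"
    using C f by (auto simp: ereal_convex_def E_def intro: convex_Times)
  moreover have "C \<times> {..<c} \<noteq> {}" "E \<noteq> {}"
    using x xE[of c] by auto
  moreover have "(C \<times> {..<c}) \<inter> E = {}"
  proof -
    have False if "y \<in> C" "r < c" "f y \<le> ereal r" for y r
    proof -
      have "ereal c \<le> ereal r"
        using min[OF \<open>y \<in> C\<close>] \<open>f y \<le> ereal r\<close> unfolding c by (rule order_trans)
      then show False
        using \<open>r < c\<close> by simp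
    qed
    then show ?thesis
      by (auto simp: E_def)
  qed
  ultimately obtain n \<beta> where n0: "n \<noteq> 0"
    and below: "\<forall>z\<in>C \<times> {..<c}. n \<bullet> z \<le> \<beta>" and above: "\<forall>z\<in>E. n \<bullet> z \<ge> \<beta>"
    using separating_hyperplane_sets by metis
  obtain a b where n: "n = (a, b)"
    by (cases n)
  have le: "a \<bullet> y + b * c \<le> \<beta>" if "y \<in> C" for y
  proof (rule tendsto_upperbound)
    show "((\<lambda>r. a \<bullet> y + b * r) \<longlongrightarrow> a \<bullet> y + b * c) (at_left c)"
      by (intro tendsto_intros)
    have "a \<bullet> y + b * r \<le> \<beta>" if "r < c" for r
      using bspec[OF below, of "(y, r)"] that \<open>y \<in> C\<close> by (simp add: n)
    then show "\<forall>\<^sub>F r in at_left c. a \<bullet> y + b * r \<le> \<beta>"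
      by (auto simp: eventually_at_filter)
  qed simp
  have \<beta>: "\<beta> = a \<bullet> x + b * c"
    using le[OF x] bspec[OF above xE[of c]] by (simp add: n)
  have "b \<ge> 0"
    using bspec[OF above xE[of "c + 1"]] by (simp add: n \<beta> algebra_simps)
  have epi: "a \<bullet> (y - x) + b * (r - c) \<ge> 0" if "f y \<le> ereal r" for y r
    using bspec[OF above, of "(y, r)"] that by (simp add: E_def n \<beta> algebra_simps)
  have "b \<noteq> 0"
  proof
    assume "b = 0"
    have "- a \<bullet> (y - x) \<le> 0" if "f y \<noteq> \<infinity>" for y
    proof -
      obtain r where "f y \<le> ereal r"
        using \<open>f y \<noteq> \<infinity>\<close> by (cases "f y") auto
      then show ?thesis
        using epi \<open>b = 0\<close> by force
    qed
    then have "- a = 0"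
      by (rule domain_normal_eq_0_if_bounded_subdifferential[OF g0 bdd])
    then show False
      using n0 \<open>b = 0\<close> by (simp add: n zero_prod_def)
  qed
  with \<open>b \<ge> 0\<close> have b: "b > 0"
    by simp
  define g where "g = - (1 / b) *\<^sub>R a"
  have "f y \<ge> f x + ereal (g \<bullet> (y - x))" for y
  proof (cases "f y")
    case (real r)
    then have "a \<bullet> (y - x) + b * (r - c) \<ge> 0"
      using epi by simp
    then have "c - (a \<bullet> (y - x)) / b \<le> r"
      using b by (simp add: field_simps)
    then show ?thesis
      by (simp add: real c g_def)
  next
    \<comment> \<open>the affine minorant given by \<open>g0\<close> excludes the value \<open>-\<infinity>\<close>\<close>
    case MInf
    have "f y \<ge> ereal c + ereal (g0 \<bullet> (y - x))"
      using g0 by (simp add: subdifferential_def flip: c)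
    then show ?thesis
      by (simp add: MInf)
  qed simp
  then have "g \<in> subdifferential f x"
    by (simp add: subdifferential_def)
  moreover have "- g \<bullet> (y - x) \<le> 0" if "y \<in> C" for y
    using le[OF that] b by (simp add: g_def \<beta> inner_diff_right divide_right_mono)
  then have "- g \<in> normal_cone C x"
    by (simp add: normal_cone_convex_iff[OF C x])
  ultimately show ?thesis ..
qed

lemma minimizer_iff_subgradient_normal:
  fixes f :: "'a::euclidean_space \<Rightarrow> ereal"
  assumes "ereal_convex f" and C: "convex C" and x: "x \<in> C"
    and "subdifferential f x \<noteq> {}" and bdd: "bounded (subdifferential f x)"
  shows "(\<forall>y\<in>C. f x \<le> f y) \<longleftrightarrow> (\<exists>g. g \<in> subdifferential f x \<and> - g \<in> normal_cone C x)"
proof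
  assume "\<forall>y\<in>C. f x \<le> f y"
  then show "\<exists>g. g \<in> subdifferential f x \<and> - g \<in> normal_cone C x"
    using minimizer_imp_subgradient_normal[OF assms] by metis
next
  assume "\<exists>g. g \<in> subdifferential f x \<and> - g \<in> normal_cone C x"
  then obtain g where g: "g \<in> subdifferential f x" and "- g \<in> normal_cone C x"
    by blast
  then have ge: "0 \<le> g \<bullet> (y - x)" if "y \<in> C" for y
    using that by (simp add: normal_cone_convex_iff[OF C x])
  show "\<forall>y\<in>C. f x \<le> f y"
  proof
    fix y assume "y \<in> C"
    have "f x \<le> f x + ereal (g \<bullet> (y - x))"
      using ge[OF \<open>y \<in> C\<close>] by (cases "f x") auto
    also have "\<dots> \<le> f y"
      using g by (simp add: subdifferential_def)
    finally show "f x \<le> f y" .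
  qed
qed

lemma superdifferential_iff_uminus_subdifferential:
  "g \<in> superdifferential f x \<longleftrightarrow> - g \<in> subdifferential (\<lambda>y. - f y) x"
proof -
  have "u \<le> v + ereal r \<longleftrightarrow> - u \<ge> - v + ereal (- r)" for u v :: ereal and r
    by (cases u; cases v) auto
  then show ?thesis
    by (simp add: superdifferential_def subdifferential_def)
qed

lemma maximizer_iff_supergradient_normal:
  fixes f :: "'a::euclidean_space \<Rightarrow> ereal"
  assumes f: "ereal_concave f" and C: "convex C" "x \<in> C"
    and ne: "superdifferential f x \<noteq> {}" and bdd: "bounded (superdifferential f x)"
  shows "(\<forall>y\<in>C. f y \<le> f x) \<longleftrightarrow> (\<exists>g. g \<in> superdifferential f x \<and> g \<in> normal_cone C x)"
proof -
  have sub: "subdifferential (\<lambda>y. - f y) x = uminus ` superdifferential f x"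
  proof (intro set_eqI iffI)
    fix h assume "h \<in> subdifferential (\<lambda>y. - f y) x"
    then show "h \<in> uminus ` superdifferential f x"
      by (intro image_eqI[of _ _ "- h"]) (auto simp: superdifferential_iff_uminus_subdifferential)
  qed (auto simp: superdifferential_iff_uminus_subdifferential)
  have "(\<forall>y\<in>C. - f x \<le> - f y)
      \<longleftrightarrow> (\<exists>g. g \<in> subdifferential (\<lambda>y. - f y) x \<and> - g \<in> normal_cone C x)"
    using f C ne bdd
    by (intro minimizer_iff_subgradient_normal) (auto simp: ereal_concave_def sub)
  then show ?thesis
    by (auto simp: sub)
qed

section \<open>Invertibility of the Hessian of a strongly convex function\<close>

lemma frechet_derivative_eq_gradient_inner:
  assumes "f differentiable (at x)"
  shows "frechet_derivative f (at x) h = gradient f x \<bullet> h"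
proof -
  interpret linear "frechet_derivative f (at x)"
    using assms by (rule linear_frechet_derivative)
  have "frechet_derivative f (at x) h
      = frechet_derivative f (at x) (\<Sum>i\<in>UNIV. (h $ i) *\<^sub>R axis i 1)"
    using basis_expansion[of h] by (simp add: scalar_mult_eq_scaleR)
  also have "\<dots> = (\<Sum>i\<in>UNIV. (h $ i) * frechet_derivative f (at x) (axis i 1))"
    by (simp add: sum scale)
  also have "\<dots> = gradient f x \<bullet> h"
    by (simp add: gradient_def inner_vec_def mult.commute)
  finally show ?thesis .
qed

lemma directional_difference_quotient_tendsto:
  fixes f :: "'a::real_normed_vector \<Rightarrow> 'b::real_normed_vector"
  assumes "(f has_derivative D) (at x)"
  shows "((\<lambda>t. (f (x + t *\<^sub>R v) - f x) /\<^sub>R t) \<longlongrightarrow> D v) (at_right 0)"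
proof -
  interpret D: bounded_linear D
    using assms by (rule has_derivative_bounded_linear)
  have "((\<lambda>t. x + t *\<^sub>R v) has_derivative (\<lambda>t. t *\<^sub>R v)) (at (0::real))"
    by (auto intro!: derivative_eq_intros)
  moreover have "(f has_derivative D) (at (x + 0 *\<^sub>R v))"
    using assms by simp
  ultimately have "((\<lambda>t. f (x + t *\<^sub>R v)) has_derivative (\<lambda>t. D (t *\<^sub>R v))) (at (0::real))"
    by (rule has_derivative_compose)
  then have "((\<lambda>t. f (x + t *\<^sub>R v)) has_derivative (\<lambda>t. D (t *\<^sub>R v))) (at_right (0::real))"
    by (rule has_derivative_at_withinI)
  then have "((\<lambda>t. (f (x + t *\<^sub>R v) - f x - t *\<^sub>R D v) /\<^sub>R norm t) \<longlongrightarrow> 0) (at_right 0)"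
    by (simp add: has_derivative_at_within D.scaleR)
  then have "((\<lambda>t. (f (x + t *\<^sub>R v) - f x - t *\<^sub>R D v) /\<^sub>R norm t + D v) \<longlongrightarrow> 0 + D v) (at_right 0)"
    by (intro tendsto_intros)
  moreover have "\<forall>\<^sub>F t in at_right 0. (f (x + t *\<^sub>R v) - f x - t *\<^sub>R D v) /\<^sub>R norm t + D v
      = (f (x + t *\<^sub>R v) - f x) /\<^sub>R t"
    by (intro eventually_at_rightI[of 0 1]) (auto simp: scaleR_diff_right)
  ultimately show ?thesis
    by (simp add: tendsto_cong)
qed

text \<open>The convexity inequality at \<open>x + t(y - x)\<close>, divided by \<open>t\<close>, in the limit \<open>t \<rightarrow> 0\<close>.\<close>

lemma strongly_convex_on_gradient_inequality:
  fixes f :: "real^'n \<Rightarrow> real"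
  assumes sc: "strongly_convex_on U \<sigma> f" and x: "x \<in> U" and y: "y \<in> U"
    and diff: "f differentiable (at x)"
  shows "f x + gradient f x \<bullet> (y - x) + \<sigma> / 2 * (norm (y - x))\<^sup>2 \<le> f y"
proof -
  let ?N = "(norm (y - x))\<^sup>2"
  have quot: "(f (x + t *\<^sub>R (y - x)) - f x) /\<^sub>R t \<le> f y - f x - \<sigma> / 2 * (1 - t) * ?N"
    if t: "0 < t" "t < 1" for t
  proof -
    have "f ((1 - t) *\<^sub>R x + t *\<^sub>R y)
        \<le> (1 - t) * f x + t * f y - \<sigma> / 2 * (1 - t) * t * (norm (x - y))\<^sup>2"
      using sc x y t unfolding strongly_convex_on_def by simp
    moreover have "(1 - t) *\<^sub>R x + t *\<^sub>R y = x + t *\<^sub>R (y - x)"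
      by (simp add: algebra_simps)
    ultimately have "f (x + t *\<^sub>R (y - x)) - f x \<le> t * (f y - f x - \<sigma> / 2 * (1 - t) * ?N)"
      by (simp add: norm_minus_commute algebra_simps)
    then show ?thesis
      using t by (simp add: field_simps)
  qed
  have "((\<lambda>t. (f (x + t *\<^sub>R (y - x)) - f x) /\<^sub>R t)
      \<longlongrightarrow> frechet_derivative f (at x) (y - x)) (at_right 0)"
    using diff by (intro directional_difference_quotient_tendsto) (simp add: frechet_derivative_works)
  moreover have "((\<lambda>t. f y - f x - \<sigma> / 2 * (1 - t) * ?N)
      \<longlongrightarrow> f y - f x - \<sigma> / 2 * (1 - 0) * ?N) (at_right 0)"
    by (intro tendsto_intros)
  moreover have "\<forall>\<^sub>F t in at_right 0. (f (x + t *\<^sub>R (y - x)) - f x) /\<^sub>R t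
      \<le> f y - f x - \<sigma> / 2 * (1 - t) * ?N"
    using quot by (intro eventually_at_rightI[of 0 1]) auto
  ultimately have "frechet_derivative f (at x) (y - x) \<le> f y - f x - \<sigma> / 2 * (1 - 0) * ?N"
    by (intro tendsto_le) auto
  then show ?thesis
    by (simp add: frechet_derivative_eq_gradient_inner[OF diff])
qed

lemma strongly_convex_on_hessian_ge:
  fixes f :: "real^'n \<Rightarrow> real"
  assumes U: "open U" and sc: "strongly_convex_on U \<sigma> f" and C2: "C2_on U f" and x: "x \<in> U"
  shows "\<sigma> * (norm v)\<^sup>2 \<le> v \<bullet> (hessian f x *v v)"
proof -
  have diff: "f differentiable (at z)" if "z \<in> U" for z
    using C2 U that by (auto simp: C2_on_def differentiable_on_eq_differentiable_at)
  have mono: "\<sigma> * (norm (y - x))\<^sup>2 \<le> (y - x) \<bullet> (gradient f y - gradient f x)" if "y \<in> U" for y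
    using strongly_convex_on_gradient_inequality[OF sc x that diff[OF x]]
      strongly_convex_on_gradient_inequality[OF sc that x diff[OF that]]
    by (simp add: norm_minus_commute inner_diff_left inner_diff_right inner_commute)
  have "gradient f differentiable (at x)"
    using C2 U x by (auto simp: C2_on_def differentiable_on_eq_differentiable_at)
  then have "(gradient f has_derivative (\<lambda>h. hessian f x *v h)) (at x)"
    unfolding hessian_def by (simp add: jacobian_works)
  then have "((\<lambda>t. v \<bullet> ((gradient f (x + t *\<^sub>R v) - gradient f x) /\<^sub>R t))
      \<longlongrightarrow> v \<bullet> (hessian f x *v v)) (at_right 0)"
    by (intro tendsto_intros directional_difference_quotient_tendsto)
  moreover have "\<forall>\<^sub>F t in at_right 0.
      \<sigma> * (norm v)\<^sup>2 \<le> v \<bullet> ((gradient f (x + t *\<^sub>R v) - gradient f x) /\<^sub>R t)"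
  proof -
    have "((\<lambda>t::real. x + t *\<^sub>R v) \<longlongrightarrow> x + 0 *\<^sub>R v) (at_right 0)"
      by (intro tendsto_intros)
    then have "\<forall>\<^sub>F t in at_right 0. x + t *\<^sub>R v \<in> U"
      using U x by (auto elim: topological_tendstoD)
    moreover have "\<forall>\<^sub>F t in at_right 0. (0::real) < t"
      by (rule eventually_at_right_less)
    ultimately show ?thesis
    proof eventually_elim
      case (elim t)
      let ?d = "v \<bullet> (gradient f (x + t *\<^sub>R v) - gradient f x)"
      have "t * (t * (\<sigma> * (norm v)\<^sup>2)) \<le> t * ?d"
        using mono[OF elim(1)] by (simp add: power_mult_distrib power2_eq_square mult_ac)
      then have "\<sigma> * (norm v)\<^sup>2 \<le> ?d / t"
        using elim(2) by (simp add: pos_le_divide_eq mult.commute)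
      then show ?case
        by (simp add: divide_inverse mult.commute)
    qed
  qed
  ultimately show ?thesis
    by (rule tendsto_lowerbound) simp
qed

lemma inv_hessian_mult_eq_0_iff:
  fixes R :: "real^'n \<Rightarrow> ereal"
  assumes R: "regularizer_on C \<sigma> R" and "\<sigma> > 0" and x: "x \<in> C"
  shows "inv_hessian R x *v w = 0 \<longleftrightarrow> w = 0"
proof -
  let ?H = "hessian (\<lambda>y. real_of_ereal (R y)) x"
  have ge: "\<sigma> * (norm v)\<^sup>2 \<le> v \<bullet> (?H *v v)" for v
    using R x by (auto simp: regularizer_on_def intro: strongly_convex_on_hessian_ge)
  have "v = 0" if "?H *v v = 0" for v
    using ge[of v] that \<open>\<sigma> > 0\<close> by (simp add: mult_le_0_iff)
  then have "invertible ?H"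
    by (simp add: invertible_left_inverse matrix_left_invertible_ker)
  then have "\<exists>A. ?H ** A = mat 1 \<and> A ** ?H = mat 1"
    by (simp add: invertible_def)
  then have "?H ** matrix_inv ?H = mat 1"
    unfolding matrix_inv_def by (rule someI2_ex) simp
  then have "?H *v (inv_hessian R x *v w) = w"
    by (simp add: matrix_vector_mul_assoc)
  then show ?thesis
    by (metis matrix_vector_mult_0_right)
qed

section \<open>Saddle points and equilibria\<close>

theorem lemma4:
  fixes X :: "(real^'n) set" and Y :: "(real^'m) set"
    and L :: "real^'n \<Rightarrow> real^'m \<Rightarrow> ereal"
    and Rx :: "real^'n \<Rightarrow> ereal" and Rg :: "real^'m \<Rightarrow> ereal"
    and \<sigma> :: real
  assumes X: "X \<noteq> {}" "convex X" "compact X"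
    and Y: "Y \<noteq> {}" "convex Y" "compact Y"
    and L_convex: "\<And>\<gamma>. ereal_convex (\<lambda>x. L x \<gamma>)"
    and L_concave: "\<And>x. ereal_concave (L x)"
    and A1_set: "saddle_points X Y L \<noteq> {}" "compact (saddle_points X Y L)"
    and A1_strict: "\<And>x \<gamma>. (x, \<gamma>) \<in> X \<times> Y - saddle_points X Y L \<Longrightarrow>
          \<exists>(xs, gs) \<in> saddle_points X Y L. L xs \<gamma> < L xs gs \<or> L xs gs < L x gs"
    and A2_usc: "\<And>x. x \<in> X \<Longrightarrow> upper_semicontinuous (L x)"
    and A2_lsc: "\<And>\<gamma>. \<gamma> \<in> Y \<Longrightarrow> lower_semicontinuous (\<lambda>x. L x \<gamma>)"
    and A3_nonempty: "\<And>x \<gamma>. x \<in> X \<Longrightarrow> \<gamma> \<in> Y \<Longrightarrow>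
          subdifferential (\<lambda>y. L y \<gamma>) x \<times> superdifferential (L x) \<gamma> \<noteq> {}"
    and A3_bounded: "\<exists>G>0. \<forall>x\<in>X. \<forall>\<gamma>\<in>Y.
          (\<forall>g \<in> subdifferential (\<lambda>y. L y \<gamma>) x. norm g \<le> G) \<and>
          (\<forall>g \<in> superdifferential (L x) \<gamma>. norm g \<le> G)"
    and \<sigma>: "\<sigma> > 0"
    and Rx: "regularizer_on X \<sigma> Rx"
    and Rg: "regularizer_on Y \<sigma> Rg"
  shows "saddle_points X Y L = equilibrium_points (X \<times> Y) (saddle_inclusion X Y Rx Rg L)"
proof (rule set_eqI, clarify)
  fix x :: "real^'n" and \<gamma> :: "real^'m"
  let ?z = "(x, \<gamma>)"
  show "?z \<in> saddle_points X Y L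
      \<longleftrightarrow> ?z \<in> equilibrium_points (X \<times> Y) (saddle_inclusion X Y Rx Rg L)"
  proof (cases "x \<in> X \<and> \<gamma> \<in> Y")
    case False
    then show ?thesis
      by (auto simp: saddle_points_def equilibrium_points_def)
  next
    case True
    then have x: "x \<in> X" and \<gamma>: "\<gamma> \<in> Y"
      by auto
    have bdd: "bounded (subdifferential (\<lambda>y. L y \<gamma>) x)" "bounded (superdifferential (L x) \<gamma>)"
      using A3_bounded x \<gamma> unfolding bounded_iff by meson+
    have ne: "subdifferential (\<lambda>y. L y \<gamma>) x \<noteq> {}" "superdifferential (L x) \<gamma> \<noteq> {}"
      using A3_nonempty[OF x \<gamma>] by auto
    have "?z \<in> saddle_points X Y L
        \<longleftrightarrow> (\<forall>y\<in>X. L x \<gamma> \<le> L y \<gamma>) \<and> (\<forall>\<delta>\<in>Y. L x \<delta> \<le> L x \<gamma>)"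
      using x \<gamma> by (auto simp: saddle_points_def)
    also have "\<dots> \<longleftrightarrow>
        (\<exists>g. g \<in> subdifferential (\<lambda>y. L y \<gamma>) x \<and> - g \<in> normal_cone X x) \<and>
        (\<exists>g. g \<in> superdifferential (L x) \<gamma> \<and> g \<in> normal_cone Y \<gamma>)"
      using minimizer_iff_subgradient_normal[OF L_convex X(2) x ne(1) bdd(1)]
        maximizer_iff_supergradient_normal[OF L_concave Y(2) \<gamma> ne(2) bdd(2)]
      by simp
    also have "\<dots> \<longleftrightarrow>
        (\<exists>g \<eta>. inv_hessian Rx x *v (g + \<eta>) = 0 \<and>
          g \<in> subdifferential (\<lambda>y. L y \<gamma>) x \<and> \<eta> \<in> normal_cone X x) \<and>
        (\<exists>g \<eta>. inv_hessian Rg \<gamma> *v (g - \<eta>) = 0 \<and>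
          g \<in> superdifferential (L x) \<gamma> \<and> \<eta> \<in> normal_cone Y \<gamma>)"
      by (simp add: inv_hessian_mult_eq_0_iff[OF Rx \<sigma> x] inv_hessian_mult_eq_0_iff[OF Rg \<sigma> \<gamma>]
          eq_neg_iff_add_eq_0[symmetric]) (metis minus_minus)
    also have "\<dots> \<longleftrightarrow> ?z \<in> equilibrium_points (X \<times> Y) (saddle_inclusion X Y Rx Rg L)"
      using x \<gamma> by (auto simp: equilibrium_points_def saddle_inclusion_def zero_prod_def eq_commute[of 0])
    finally show ?thesis .
  qed
qed

end
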